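(* For integers $1\leq k\leq n$, let $\hat{B}_{k,n}$ be the set of all $(x_1,\ldots,x_n)\in[0,1]^n$ with $x_{i+1}+\cdots+x_{i+k}\leq1$ for all $0\leq i\leq n-k$. Then the Ehrhart $h^*$-polynomial $E^*(\hat{B}_{k,n},z)$ is palindromic, i.e. writing it as $\sum_{h=0}^d a_hz^h$ with $d$ its degree, $a_h=a_{d-h}$ for all $0\leq h\leq d$.
   Context: For a lattice polytope $P\subset\mathbb{R}^n$, $E(P,t)=\#(tP\cap\mathbb{Z}^n)$ for integers $t\geq0$ and $E^*(P,z)=(1-z)^{n+1}\sum_{t\geq0}E(P,t)z^t$, which is a polynomial. ($\hat{B}_{k,n}$ is a lattice polytope.) *)

theory Defs
  imports
    "Jordan_Normal_Form.Matrix"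
    "HOL-Computational_Algebra.Polynomial_FPS"
begin

text \<open>
  Points of \<open>\<real>\<^sup>n\<close> are the elements of \<^term>\<open>carrier_vec n\<close>, whose coordinates are indexed
  from \<open>0\<close> to \<open>n - 1\<close>; the coordinate \<open>x\<^sub>j\<close> of the usual notation is \<open>x $ (j - 1)\<close>.
\<close>

definition int_lattice :: "nat \<Rightarrow> real vec set" where
  "int_lattice n = {x \<in> carrier_vec n. \<forall>i<n. x $ i \<in> \<int>}"

definition ehrhart :: "nat \<Rightarrow> real vec set \<Rightarrow> nat \<Rightarrow> nat" where
  "ehrhart n P t = card ((\<lambda>x. real t \<cdot>\<^sub>v x) ` P \<inter> int_lattice n)"

definition hstar :: "nat \<Rightarrow> real vec set \<Rightarrow> int fps" where
  "hstar n P = (1 - fps_X) ^ (n + 1) * Abs_fps (\<lambda>t. int (ehrhart n P t))"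

definition Bhat :: "nat \<Rightarrow> nat \<Rightarrow> real vec set" where
  "Bhat k n = {x \<in> carrier_vec n. (\<forall>i<n. 0 \<le> x $ i \<and> x $ i \<le> 1) \<and>
                 (\<forall>i\<le>n - k. (\<Sum>j=i..<i + k. x $ j) \<le> 1)}"

definition palindromic :: "'a::zero poly \<Rightarrow> bool" where
  "palindromic p \<longleftrightarrow> (\<forall>h\<le>degree p. coeff p h = coeff p (degree p - h))"

end

theory Submission
  imports Defs "HOL-Library.Product_Plus" "HOL-Library.Function_Algebras"
begin

text \<open>
  Choosing the coordinates of a lattice point of \<open>t B\<close> from left to right, \<open>x\<^sub>j\<close> ranges over
  \<open>0 \<le> x\<^sub>j \<le> t - (sum of the previous k - 1 coordinates)\<close>, and earlier windows keep this bound
  nonnegative. So the Ehrhart function is an iterated signed sum, hence a polynomial \<open>g\<close> in \<open>t\<close> of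
  degree at most \<open>n\<close>. Evaluating that signed sum at \<open>- t - k - 1\<close> and substituting \<open>x = - 1 - y\<close>
  turns it into the same count with sign \<open>(-1)\<^sup>n\<close>. Thus \<open>g (- t - k - 1) = (-1)\<^sup>n g t\<close> and
  \<open>g\<close> vanishes on \<open>- k, \<dots>, - 1\<close>, which is the symmetry of the numerator about \<open>(n - k) / 2\<close>.
\<close>

section \<open>Functions with vanishing iterated differences\<close>

text \<open>Stands for "polynomial of degree less than \<open>d\<close>": all \<open>d\<close>-fold
  differences vanish. A general abelian group as domain lets the dilation factor and the coordinates
  vary jointly.\<close>

primrec degree_less :: "nat \<Rightarrow> ('a::ab_group_add \<Rightarrow> int) \<Rightarrow> bool" where
  "degree_less 0 f \<longleftrightarrow> (\<forall>w. f w = 0)"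
| "degree_less (Suc d) f \<longleftrightarrow> (\<forall>v. degree_less d (\<lambda>w. f (w + v) - f w))"

lemma degree_less_zero: "degree_less d (\<lambda>w. 0)"
  by (induction d) auto

lemma degree_less_add:
  "degree_less d f \<Longrightarrow> degree_less d g \<Longrightarrow> degree_less d (\<lambda>w. f w + g w)"
proof (induction d arbitrary: f g)
  case (Suc d)
  have "degree_less d (\<lambda>w. (f (w + v) - f w) + (g (w + v) - g w))" for v
    using Suc by auto
  then show ?case by (simp add: algebra_simps)
qed auto

lemma degree_less_minus:
  "degree_less d f \<Longrightarrow> degree_less d (\<lambda>w. - f w)"
proof (induction d arbitrary: f)
  case (Suc d)
  have "degree_less d (\<lambda>w. - (f (w + v) - f w))" for v
    using Suc.prems by (intro Suc.IH) simp
  then show ?case by (simp add: algebra_simps)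
qed auto

lemma degree_less_sum:
  "(\<And>i. i \<in> A \<Longrightarrow> degree_less d (f i)) \<Longrightarrow> degree_less d (\<lambda>w. \<Sum>i\<in>A. f i w)"
  by (induction A rule: infinite_finite_induct) (auto simp: degree_less_zero degree_less_add)

lemma degree_less_affine:
  assumes "degree_less d f" and A: "\<And>v w. A (w + v) = A w + B v"
  shows "degree_less d (\<lambda>w. f (A w))"
  using assms(1)
proof (induction d arbitrary: f)
  case (Suc d)
  show ?case unfolding degree_less.simps
  proof
    fix v
    have "degree_less d (\<lambda>w. f (w + B v) - f w)" using Suc.prems by simp
    from Suc.IH[OF this] show "degree_less d (\<lambda>w. f (A (w + v)) - f (A w))"
      by (simp add: A)
  qed
qed auto

text \<open>Up to sign the sum is the \<open>d\<close>-fold difference of \<open>g\<close> with step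
  \<open>-1\<close>. Pascal's rule reduces it to two sums of the next lower order, which the
  induction hypothesis makes equal.\<close>

lemma degree_less_alternating_sum:
  fixes g :: "int \<Rightarrow> int"
  assumes "degree_less d g"
  shows "(\<Sum>i\<le>d. (-1) ^ i * int (d choose i) * g (h - int i)) = 0"
  using assms
proof (induction d arbitrary: g)
  case (Suc d)
  let ?a = "\<lambda>i. (-1) ^ i * int (d choose i)"
  have "degree_less d (\<lambda>w. g (w + (-1)) - g w)"
    using Suc.prems unfolding degree_less.simps by blast
  from Suc.IH[OF this]
  have IH: "(\<Sum>i\<le>d. ?a i * g (h - int i - 1)) = (\<Sum>i\<le>d. ?a i * g (h - int i))"
    by (simp add: right_diff_distrib sum_subtractf)
  have "(\<Sum>i\<le>Suc d. (-1) ^ i * int (Suc d choose i) * g (h - int i))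
      = g h + (\<Sum>i\<le>d. (-1) ^ Suc i * int (Suc d choose Suc i) * g (h - int (Suc i)))"
    by (subst sum.atMost_Suc_shift) simp
  also have "\<dots> = g h + (\<Sum>i\<le>d. ?a (Suc i) * g (h - int (Suc i)))
                      - (\<Sum>i\<le>d. ?a i * g (h - int i - 1))"
    by (simp add: algebra_simps sum_subtractf sum.distrib sum_negf)
  also have "g h + (\<Sum>i\<le>d. ?a (Suc i) * g (h - int (Suc i))) = (\<Sum>i\<le>Suc d. ?a i * g (h - int i))"
    by (subst sum.atMost_Suc_shift) simp
  also have "\<dots> = (\<Sum>i\<le>d. ?a i * g (h - int i))" by simp
  finally show ?case using IH by simp
qed auto

section \<open>Signed sums\<close>

text \<open>The sum over \<open>0 \<le> x \<le> b\<close>, continued to negative \<open>b\<close> so that increasing \<open>b\<close> by one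
  always adds \<open>f (b + 1)\<close>.\<close>

definition signed_sum :: "(int \<Rightarrow> int) \<Rightarrow> int \<Rightarrow> int" where
  "signed_sum f b = (\<Sum>x\<in>{0..b}. f x) - (\<Sum>x\<in>{b + 1..-1}. f x)"

lemma signed_sum_nonneg: "-1 \<le> b \<Longrightarrow> signed_sum f b = (\<Sum>x\<in>{0..b}. f x)"
  by (simp add: signed_sum_def)

text \<open>One-variable reciprocity: at the bound \<open>- b - 2\<close> only the subtracted range
  \<open>{- 1 - b..-1}\<close> remains, and \<open>x = - 1 - y\<close> carries it to
  \<open>{0..b}\<close>. For \<open>b = -1\<close> both are empty.\<close>

lemma signed_sum_reflect:
  assumes "-1 \<le> b"
  shows "signed_sum f (- b - 2) = - (\<Sum>y\<in>{0..b}. f (-1 - y))"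
proof -
  have "(\<Sum>x\<in>{-1 - b..-1}. f x) = (\<Sum>y\<in>{0..b}. f (-1 - y))"
    by (rule sum.reindex_bij_witness[where i = "\<lambda>y. -1 - y" and j = "\<lambda>y. -1 - y"]) auto
  then show ?thesis using assms by (simp add: signed_sum_def)
qed

lemma signed_sum_diff: "signed_sum (\<lambda>x. f x - g x) b = signed_sum f b - signed_sum g b"
  by (simp add: signed_sum_def sum_subtractf)

lemma signed_sum_step: "signed_sum f (b + 1) = signed_sum f b + f (b + 1)"
proof (cases "b + 1 \<ge> 0")
  case True
  then have "{0..b + 1} = insert (b + 1) {0..b}" by auto
  then show ?thesis using True by (simp add: signed_sum_def)
next
  case False
  then have "{b + 1..-1} = insert (b + 1) {b + 1 + 1..-1}" by auto
  then show ?thesis using False by (simp add: signed_sum_def)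
qed

text \<open>As \<open>signed_sum_step\<close> holds for every bound, induction runs in both
  directions from \<open>c = 0\<close>. The term \<open>f b\<close> corrects for the sum on the
  right starting at \<open>j = 0\<close>.\<close>

lemma signed_sum_shift:
  "signed_sum f (b + c) - signed_sum f b = signed_sum (\<lambda>j. f (b + j)) c - f b"
proof (induction c rule: int_induct[where k = 0])
  case base
  show ?case by (simp add: signed_sum_def)
next
  case (step1 c)
  then show ?case
    using signed_sum_step[of f "b + c"] signed_sum_step[of "\<lambda>j. f (b + j)" c]
    by (simp add: algebra_simps)
next
  case (step2 c)
  then show ?case
    using signed_sum_step[of f "b + (c - 1)"] signed_sum_step[of "\<lambda>j. f (b + j)" "c - 1"]
    by (simp add: algebra_simps)
qed

text \<open>Discrete integration raises the degree by one. A difference along \<open>v\<close> has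
  two parts: the integrand changes under the same bound, where induction applies, and the bound
  moves by \<open>l v\<close>, which is constant in \<open>w\<close> and so adds a fixed combination
  of values of \<open>f\<close>.\<close>

lemma degree_less_signed_sum:
  fixes f :: "'a::ab_group_add \<times> int \<Rightarrow> int" and l :: "'a \<Rightarrow> int"
  assumes "degree_less d f" and l: "\<And>v w. l (w + v) = l w + l v"
  shows "degree_less (Suc d) (\<lambda>w. signed_sum (\<lambda>x. f (w, x)) (l w))"
  using assms(1)
proof (induction d arbitrary: f)
  case 0
  then have "f = (\<lambda>_. 0)" by auto
  then show ?case by (simp add: signed_sum_def)
next
  case (Suc d)
  have "degree_less (Suc d) (\<lambda>w. signed_sum (\<lambda>x. f (w + v, x)) (l (w + v))
          - signed_sum (\<lambda>x. f (w, x)) (l w))" for v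
  proof -
    have inner: "degree_less (Suc d) (\<lambda>w. signed_sum (\<lambda>x. f ((w, x) + (v, 0)) - f (w, x)) (l w))"
      using Suc.IH[of "\<lambda>p. f (p + (v, 0)) - f p"] Suc.prems by simp
    have shift: "degree_less (Suc d) (\<lambda>w. f (w + v, l w + j))" for j
      by (rule degree_less_affine[OF Suc.prems, where B = "\<lambda>u. (u, l u)"])
        (simp add: l algebra_simps)
    have outer: "degree_less (Suc d) (\<lambda>w. signed_sum (\<lambda>j. f (w + v, l w + j)) (l v) + - f (w + v, l w + 0))"
      unfolding signed_sum_def diff_conv_add_uminus
      by (intro degree_less_add degree_less_minus degree_less_sum shift)
    have "signed_sum (\<lambda>x. f (w + v, x)) (l (w + v)) - signed_sum (\<lambda>x. f (w, x)) (l w)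
        = signed_sum (\<lambda>x. f ((w, x) + (v, 0)) - f (w, x)) (l w)
          + (signed_sum (\<lambda>j. f (w + v, l w + j)) (l v) + - f (w + v, l w + 0))" for w
      using signed_sum_shift[of "\<lambda>x. f (w + v, x)" "l w" "l v"]
      by (simp add: signed_sum_diff l)
    then show ?thesis using degree_less_add[OF inner outer] by simp
  qed
  then show ?case by simp
qed

section \<open>The iterated sum\<close>

text \<open>\<open>T\<close> is the dilation factor, \<open>w\<close> holds the coordinates before
  \<open>j\<close>, and \<open>m\<close> coordinates remain. For \<open>j < k - 1\<close> truncated
  subtraction keeps just the existing predecessors of \<open>j\<close>.\<close>

primrec iterated_sum :: "nat \<Rightarrow> nat \<Rightarrow> nat \<Rightarrow> int \<Rightarrow> (nat \<Rightarrow> int) \<Rightarrow> int" where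
  "iterated_sum k 0 j T w = 1"
| "iterated_sum k (Suc m) j T w =
     signed_sum (\<lambda>x. iterated_sum k m (Suc j) T (w(j := x))) (T - (\<Sum>i\<in>{Suc j - k..<j}. w i))"

text \<open>The degree is joint in \<open>T\<close> and \<open>w\<close> because inner bounds depend
  on outer summation variables. Each summation raises it by one, the update of \<open>w\<close> and
  the bound being additive.\<close>

lemma degree_less_iterated_sum:
  "degree_less (Suc m) (\<lambda>(T, w). iterated_sum k m j T w)"
proof (induction m arbitrary: j)
  case 0
  show ?case by simp
next
  case (Suc m)
  define f where "f = (\<lambda>((T, w), x). iterated_sum k m (Suc j) T (w(j := x)))"
  define l where "l = (\<lambda>(T, w). T - (\<Sum>i\<in>{Suc j - k..<j}. w i) :: int)"
  have "degree_less (Suc m) (\<lambda>p. (\<lambda>(T, w). iterated_sum k m (Suc j) T w)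
          ((\<lambda>((T, w), x). (T, w(j := x))) p))"
    by (rule degree_less_affine[OF Suc.IH, where B = "\<lambda>((T, w), x). (T, w(j := x))"])
      (auto simp: fun_eq_iff split: prod.splits)
  then have f: "degree_less (Suc m) f"
    by (simp add: f_def case_prod_unfold)
  have "l (w + v) = l w + l v" for v w
    by (auto simp: l_def sum.distrib split: prod.splits)
  from degree_less_signed_sum[OF f this]
  show ?case by (simp add: f_def l_def case_prod_unfold)
qed

lemma degree_less_iterated_sum_scale:
  "degree_less (Suc n) (\<lambda>T. iterated_sum k n 0 T 0)"
proof -
  have "degree_less (Suc n) (\<lambda>T. (\<lambda>(T, w). iterated_sum k n 0 T w) (T, 0))"
    by (rule degree_less_affine[OF degree_less_iterated_sum, where B = "\<lambda>T. (T, 0)"]) simp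
  then show ?thesis by simp
qed

section \<open>Lattice points\<close>

text \<open>Functions vanishing from \<open>n\<close> on encode integer vectors. The integer
  \<open>t\<close> admits the negative arguments of the reciprocity.\<close>

definition window_points :: "nat \<Rightarrow> nat \<Rightarrow> int \<Rightarrow> (nat \<Rightarrow> int) set" where
  "window_points k n t = {u. (\<forall>i<n. 0 \<le> u i) \<and> (\<forall>i\<ge>n. u i = 0) \<and>
     (\<forall>i\<le>n - k. (\<Sum>j=i..<i + k. u j) \<le> t)}"

text \<open>Windows are indexed here by their last position, so early ones are cut off at
  \<open>0\<close>; by nonnegativity their sums are bounded by that of the first complete
  window.\<close>

lemma window_sum_le:
  fixes u :: "nat \<Rightarrow> int"
  assumes "k \<le> n" and "\<And>i. i < n \<Longrightarrow> 0 \<le> u i"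
    and "\<And>i. i \<le> n - k \<Longrightarrow> (\<Sum>j=i..<i + k. u j) \<le> t" and "j < n"
  shows "(\<Sum>i\<in>{Suc j - k..<Suc j}. u i) \<le> t"
proof -
  let ?i = "Suc j - k"
  have "(\<Sum>i\<in>{?i..<Suc j}. u i) \<le> (\<Sum>i\<in>{?i..<?i + k}. u i)"
    using assms by (intro sum_mono2) auto
  also have "\<dots> \<le> t" using assms by (intro assms(3)) auto
  finally show ?thesis .
qed

lemma window_points_le:
  assumes "1 \<le> k" "k \<le> n" "u \<in> window_points k n t" "i < n"
  shows "u i \<le> t"
proof -
  have "u i \<le> (\<Sum>i\<in>{Suc i - k..<Suc i}. u i)"
    using assms by (intro member_le_sum) (auto simp: window_points_def)
  also have "\<dots> \<le> t"
    using assms by (intro window_sum_le[of k n]) (auto simp: window_points_def)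
  finally show ?thesis .
qed

lemma finite_window_points:
  assumes "1 \<le> k" "k \<le> n"
  shows "finite (window_points k n t)"
proof (rule finite_subset)
  show "window_points k n t \<subseteq> {u. \<forall>i. (i \<in> {..<n} \<longrightarrow> u i \<in> {0..t}) \<and> (i \<notin> {..<n} \<longrightarrow> u i = 0)}"
    using window_points_le[OF assms] by (auto simp: window_points_def)
  show "finite {u. \<forall>i. (i \<in> {..<n} \<longrightarrow> u i \<in> {0..t}) \<and> (i \<notin> {..<n} \<longrightarrow> u i = 0)}"
    by (rule finite_set_of_finite_funs) auto
qed

section \<open>Counting points with a prescribed prefix\<close>

definition extensions :: "nat \<Rightarrow> nat \<Rightarrow> int \<Rightarrow> nat \<Rightarrow> (nat \<Rightarrow> int) \<Rightarrow> (nat \<Rightarrow> int) set" where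
  "extensions k n t j y = {u \<in> window_points k n t. \<forall>i<j. u i = y i}"

text \<open>Points are sorted by coordinate \<open>j\<close>, which is at most the room left in the
  window ending there. A larger \<open>b\<close> only adds empty fibres, a freedom used in
  \<open>iterated_sum_reflect\<close> when \<open>j < k - 1\<close>.\<close>

lemma card_extensions_split:
  assumes k: "1 \<le> k" "k \<le> n" and j: "j < n"
    and b: "t - (\<Sum>i\<in>{Suc j - k..<j}. y i) \<le> b"
  shows "int (card (extensions k n t j y)) =
    (\<Sum>x\<in>{0..b}. int (card (extensions k n t (Suc j) (y(j := x)))))"
proof -
  have "extensions k n t j y = (\<Union>x\<in>{0..b}. extensions k n t (Suc j) (y(j := x)))" (is "?L = ?R")
  proof
    show "?L \<subseteq> ?R"
    proof
      fix u assume u: "u \<in> ?L"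
      then have pts: "u \<in> window_points k n t" and eq: "\<And>i. i < j \<Longrightarrow> u i = y i"
        by (auto simp: extensions_def)
      have "(\<Sum>i\<in>{Suc j - k..<Suc j}. u i) \<le> t"
        using pts k j by (intro window_sum_le[of k n]) (auto simp: window_points_def)
      moreover have "(\<Sum>i\<in>{Suc j - k..<Suc j}. u i) = (\<Sum>i\<in>{Suc j - k..<j}. y i) + u j"
        using k eq by (subst sum.atLeastLessThan_Suc) auto
      ultimately have "u j \<in> {0..b}" using b pts j by (auto simp: window_points_def)
      moreover have "u \<in> extensions k n t (Suc j) (y(j := u j))"
        using pts eq by (auto simp: extensions_def less_Suc_eq)
      ultimately show "u \<in> ?R" by blast
    qed
    show "?R \<subseteq> ?L" by (auto simp: extensions_def less_Suc_eq)
  qed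
  moreover have "card ?R = (\<Sum>x\<in>{0..b}. card (extensions k n t (Suc j) (y(j := x))))"
    using finite_window_points[OF k, of t]
    by (intro card_UN_disjoint) (auto simp: extensions_def)
  ultimately show ?thesis by simp
qed

text \<open>The slack \<open>k - Suc j\<close> is positive only while the window ending at
  \<open>j\<close> is incomplete; complete windows obey the bound \<open>t\<close> itself.\<close>

lemma card_extensions_full:
  assumes k: "1 \<le> k" "k \<le> n"
    and y: "\<And>i. i < n \<Longrightarrow> 0 \<le> y i"
    and win: "\<And>j. j < n \<Longrightarrow> (\<Sum>i\<in>{Suc j - k..<Suc j}. y i) \<le> t + int (k - Suc j)"
  shows "card (extensions k n t n y) = 1"
proof -
  let ?u = "\<lambda>i. if i < n then y i else 0"
  have "(\<Sum>j=i..<i + k. ?u j) \<le> t" if "i \<le> n - k" for i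
  proof -
    have "(\<Sum>j=i..<i + k. ?u j) = (\<Sum>j=i..<i + k. y j)"
      using that k by (intro sum.cong) auto
    then show ?thesis using win[of "i + k - 1"] that k by simp
  qed
  then have "extensions k n t n y = {?u}"
    using y by (auto simp: extensions_def window_points_def fun_eq_iff)
  then show ?thesis by simp
qed

lemma previous_window_sum_le:
  fixes y :: "nat \<Rightarrow> int"
  assumes "1 \<le> k" "0 < j" "\<And>i. i < j \<Longrightarrow> 0 \<le> y i"
    and "(\<Sum>i\<in>{j - k..<j}. y i) \<le> s"
  shows "(\<Sum>i\<in>{Suc j - k..<j}. y i) \<le> s"
proof -
  have "(\<Sum>i\<in>{Suc j - k..<j}. y i) \<le> (\<Sum>i\<in>{j - k..<j}. y i)"
    using assms(3) by (intro sum_mono2) auto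
  then show ?thesis using assms by simp
qed

lemma window_sum_update:
  fixes y :: "nat \<Rightarrow> int"
  assumes "1 \<le> k" "i \<le> j"
  shows "(\<Sum>l\<in>{Suc i - k..<Suc i}. (y(j := x)) l) =
    (if i = j then (\<Sum>l\<in>{Suc j - k..<j}. y l) + x else (\<Sum>l\<in>{Suc i - k..<Suc i}. y l))"
proof (cases "i = j")
  case True
  have "(\<Sum>l\<in>{Suc j - k..<Suc j}. (y(j := x)) l) = (\<Sum>l\<in>{Suc j - k..<j}. (y(j := x)) l) + x"
    using assms by (subst sum.atLeastLessThan_Suc) auto
  also have "(\<Sum>l\<in>{Suc j - k..<j}. (y(j := x)) l) = (\<Sum>l\<in>{Suc j - k..<j}. y l)"
    by (intro sum.cong) auto
  finally show ?thesis using True by simp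
next
  case False
  then show ?thesis using assms by (auto intro!: sum.cong)
qed

text \<open>The conditions on the prefix keep every bound at least \<open>-1\<close>, so each signed
  sum is an ordinary sum over the next coordinate.\<close>

lemma iterated_sum_eq_card:
  assumes k: "1 \<le> k" "k \<le> n" and t: "0 \<le> t"
    and "j + m = n" and "\<And>i. i < j \<Longrightarrow> 0 \<le> y i"
    and "\<And>i. i < j \<Longrightarrow> (\<Sum>l\<in>{Suc i - k..<Suc i}. y l) \<le> t"
  shows "iterated_sum k m j t y = int (card (extensions k n t j y))"
  using assms(4-6)
proof (induction m arbitrary: j y)
  case 0
  have "card (extensions k n t n y) = 1"
    by (rule card_extensions_full[OF k]) (use 0 in force)+
  then show ?case using 0 by simp
next
  case (Suc m)
  define b where "b = t - (\<Sum>i\<in>{Suc j - k..<j}. y i)"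
  have b: "-1 \<le> b"
  proof (cases "j = 0")
    case False
    have "(\<Sum>i\<in>{Suc j - k..<j}. y i) \<le> t"
      using Suc.prems(2) Suc.prems(3)[of "j - 1"] False k
      by (intro previous_window_sum_le) auto
    then show ?thesis by (simp add: b_def)
  qed (use t b_def in simp)
  have step: "iterated_sum k m (Suc j) t (y(j := x)) = int (card (extensions k n t (Suc j) (y(j := x))))"
    if "x \<in> {0..b}" for x
  proof (rule Suc.IH)
    fix i assume "i < Suc j"
    then show "(\<Sum>l\<in>{Suc i - k..<Suc i}. (y(j := x)) l) \<le> t"
      using that Suc.prems(3)[of i] k by (subst window_sum_update) (auto simp: b_def)
  qed (use Suc.prems that in auto)
  have "iterated_sum k (Suc m) j t y = (\<Sum>x\<in>{0..b}. iterated_sum k m (Suc j) t (y(j := x)))"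
    using b by (simp add: b_def signed_sum_nonneg)
  also have "\<dots> = int (card (extensions k n t j y))"
    using Suc.prems by (simp add: step card_extensions_split[OF k, of j t y b] b_def)
  finally show ?case .
qed

text \<open>Substituting \<open>x = - 1 - y\<close> reflects every summation range; the initial partial windows only
  obey the weaker bound \<open>t + (k - j)\<close>, which the first complete window makes irrelevant.\<close>

lemma iterated_sum_reflect:
  assumes k: "1 \<le> k" "k \<le> n" and t: "- int k \<le> t"
    and "j + m = n" and "\<And>i. i < j \<Longrightarrow> 0 \<le> y i"
    and "\<And>i. i < j \<Longrightarrow> (\<Sum>l\<in>{Suc i - k..<Suc i}. y l) \<le> t + int (k - Suc i)"
    and "\<And>i. i < j \<Longrightarrow> w i = - 1 - y i"
  shows "iterated_sum k m j (- t - int k - 1) w = (-1) ^ m * int (card (extensions k n t j y))"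
  using assms(4-7)
proof (induction m arbitrary: j y w)
  case 0
  have "card (extensions k n t n y) = 1"
    by (rule card_extensions_full[OF k]) (use 0 in force)+
  then show ?case using 0 by simp
next
  case (Suc m)
  define b where "b = t + int (k - Suc j) - (\<Sum>i\<in>{Suc j - k..<j}. y i)"
  \<comment> \<open>The slack falls by at most one from position \<open>j - 1\<close> to
    \<open>j\<close>, so \<open>b\<close> never drops below \<open>-1\<close>; for
    \<open>j = 0\<close> this is the assumption \<open>- int k \<le> t\<close>.\<close>
  have b: "-1 \<le> b"
  proof (cases "j = 0")
    case False
    have "(\<Sum>i\<in>{Suc j - k..<j}. y i) \<le> t + int (k - j)"
      using Suc.prems(2) Suc.prems(3)[of "j - 1"] False k
      by (intro previous_window_sum_le) auto
    then show ?thesis by (simp add: b_def)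
  qed (use t k b_def in simp)
  \<comment> \<open>Each of the \<open>min j (k - 1)\<close> terms adds \<open>1\<close> to the
    limit, and \<open>min j (k - 1) - k - 1\<close> equals \<open>- 2\<close> minus the slack
    \<open>k - Suc j\<close>.\<close>
  have "(\<Sum>i\<in>{Suc j - k..<j}. w i) = (\<Sum>i\<in>{Suc j - k..<j}. - 1 - y i)"
    using Suc.prems(4) by (intro sum.cong) auto
  also have "\<dots> = - int (j - (Suc j - k)) - (\<Sum>i\<in>{Suc j - k..<j}. y i)"
    by (simp add: sum_subtractf)
  finally have lim: "- t - int k - 1 - (\<Sum>i\<in>{Suc j - k..<j}. w i) = - b - 2"
    using k by (cases "Suc j \<le> k") (auto simp: b_def)
  have step: "iterated_sum k m (Suc j) (- t - int k - 1) (w(j := - 1 - x))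
      = (-1) ^ m * int (card (extensions k n t (Suc j) (y(j := x))))"
    if "x \<in> {0..b}" for x
  proof (rule Suc.IH)
    fix i assume "i < Suc j"
    then show "(\<Sum>l\<in>{Suc i - k..<Suc i}. (y(j := x)) l) \<le> t + int (k - Suc i)"
      using that Suc.prems(3)[of i] k by (subst window_sum_update) (auto simp: b_def)
  qed (use Suc.prems that in auto)
  have "iterated_sum k (Suc m) j (- t - int k - 1) w
      = - (\<Sum>x\<in>{0..b}. iterated_sum k m (Suc j) (- t - int k - 1) (w(j := - 1 - x)))"
    using b by (simp add: lim signed_sum_reflect)
  also have "\<dots> = (-1) ^ Suc m * int (card (extensions k n t j y))"
    using Suc.prems
    by (simp add: step card_extensions_split[OF k, of j t y b] b_def sum_distrib_left sum_negf)
  finally show ?case .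
qed

section \<open>Reciprocity and its boundary cases\<close>

lemma iterated_sum_window_points:
  assumes "1 \<le> k" "k \<le> n" "0 \<le> t"
  shows "iterated_sum k n 0 t 0 = int (card (window_points k n t))"
  using iterated_sum_eq_card[OF assms, of 0 n 0] by (simp add: extensions_def)

lemma iterated_sum_reciprocity:
  assumes "1 \<le> k" "k \<le> n" "- int k \<le> t"
  shows "iterated_sum k n 0 (- t - int k - 1) 0 = (-1) ^ n * int (card (window_points k n t))"
  using iterated_sum_reflect[OF assms, of 0 n] by (simp add: extensions_def)

lemma window_points_negative:
  assumes "1 \<le> k" "k \<le> n" "t < 0"
  shows "window_points k n t = {}"
proof -
  have False if "u \<in> window_points k n t" for u
    using window_points_le[OF assms(1,2) that, of 0] that assms
    by (auto simp: window_points_def dest!: spec[of _ "0::nat"])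
  then show ?thesis by blast
qed

lemma window_points_zero:
  assumes "1 \<le> k" "k \<le> n"
  shows "window_points k n 0 = {0}"
proof
  show "window_points k n 0 \<subseteq> {0}"
  proof
    fix u assume u: "u \<in> window_points k n 0"
    have "u i = 0" for i
      using window_points_le[OF assms u, of i] u by (cases "i < n") (auto simp: window_points_def)
    then show "u \<in> {0}" by (auto simp: fun_eq_iff)
  qed
qed (auto simp: window_points_def)

lemma ehrhart_Bhat:
  assumes k: "1 \<le> k" "k \<le> n"
  shows "ehrhart n (Bhat k n) t = card (window_points k n (int t))"
proof -
  let ?v = "\<lambda>u::nat \<Rightarrow> int. vec n (\<lambda>i. real_of_int (u i))"
  have "(\<lambda>x. real t \<cdot>\<^sub>v x) ` Bhat k n \<inter> int_lattice n = ?v ` window_points k n (int t)"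
    (is "?L = ?R")
  proof
    show "?L \<subseteq> ?R"
    proof
      fix x assume "x \<in> ?L"
      then obtain z where z: "z \<in> Bhat k n" and x: "x = real t \<cdot>\<^sub>v z" and xi: "x \<in> int_lattice n"
        by auto
      have dz: "dim_vec z = n" using z by (auto simp: Bhat_def)
      define u where "u = (\<lambda>i. if i < n then \<lfloor>x $ i\<rfloor> else 0)"
      have ux: "real_of_int (u i) = real t * z $ i" if "i < n" for i
        using xi that x dz by (auto simp: u_def int_lattice_def elim!: Ints_cases)
      have "(\<Sum>j=i..<i + k. u j) \<le> int t" if "i \<le> n - k" for i
      proof -
        have "real_of_int (\<Sum>j=i..<i + k. u j) = (\<Sum>j=i..<i + k. real t * z $ j)"
          using that k by (auto simp: ux intro!: sum.cong)
        also have "\<dots> = real t * (\<Sum>j=i..<i + k. z $ j)" by (simp add: sum_distrib_left)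
        also have "\<dots> \<le> real t * 1" using z that by (intro mult_left_mono) (auto simp: Bhat_def)
        finally show ?thesis by linarith
      qed
      moreover have "0 \<le> u i" if "i < n" for i
      proof -
        have "0 \<le> real_of_int (u i)" using z that by (simp add: ux Bhat_def)
        then show ?thesis by simp
      qed
      ultimately have "u \<in> window_points k n (int t)" by (auto simp: window_points_def u_def)
      moreover have "x = ?v u" using dz by (intro eq_vecI) (auto simp: ux x)
      ultimately show "x \<in> ?R" by blast
    qed
    show "?R \<subseteq> ?L"
    proof
      fix x assume "x \<in> ?R"
      then obtain u where u: "u \<in> window_points k n (int t)" and x: "x = ?v u" by auto
      \<comment> \<open>For \<open>t = 0\<close> division yields the zero vector, which lies in
        \<open>Bhat k n\<close>; \<open>window_points_zero\<close> gives \<open>u = 0\<close>, so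
        \<open>x\<close> is still \<open>real t\<close> times \<open>z\<close>.\<close>
      define z where "z = vec n (\<lambda>i. real_of_int (u i) / real t)"
      have "z $ i \<le> 1" "0 \<le> z $ i" if "i < n" for i
        using window_points_le[OF k u that] u that
        by (auto simp: z_def window_points_def divide_le_eq)
      moreover have "(\<Sum>j=i..<i + k. z $ j) \<le> 1" if "i \<le> n - k" for i
      proof -
        have "(\<Sum>j=i..<i + k. z $ j) = (\<Sum>j=i..<i + k. real_of_int (u j) / real t)"
          using that k by (auto simp: z_def intro!: sum.cong)
        also have "\<dots> = real_of_int (\<Sum>j=i..<i + k. u j) / real t"
          by (simp add: sum_divide_distrib)
        also have "\<dots> \<le> 1"
        proof -
          have "(\<Sum>j=i..<i + k. u j) \<le> int t" using u that by (auto simp: window_points_def)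
          then have "real_of_int (\<Sum>j=i..<i + k. u j) \<le> real t" by linarith
          then show ?thesis by (auto simp: divide_le_eq)
        qed
        finally show ?thesis .
      qed
      ultimately have "z \<in> Bhat k n" by (auto simp: Bhat_def z_def)
      moreover have "x = real t \<cdot>\<^sub>v z"
        using window_points_zero[OF k] u by (intro eq_vecI) (auto simp: x z_def)
      moreover have "x \<in> int_lattice n" by (auto simp: x int_lattice_def)
      ultimately show "x \<in> ?L" by blast
    qed
  qed
  moreover have "inj_on ?v (window_points k n (int t))"
  proof (rule inj_onI)
    fix u u' assume u: "u \<in> window_points k n (int t)" "u' \<in> window_points k n (int t)" "?v u = ?v u'"
    have "u i = u' i" for i
    proof (cases "i < n")
      case True
      then have "?v u $ i = ?v u' $ i" using u by simp
      then show ?thesis using True by simp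
    qed (use u in \<open>auto simp: window_points_def\<close>)
    then show "u = u'" by auto
  qed
  ultimately show ?thesis by (simp add: ehrhart_def card_image)
qed

section \<open>Symmetry of the numerator\<close>

lemma one_minus_X_power_nth:
  "fps_nth ((1 - fps_X) ^ d :: int fps) i = (-1) ^ i * int (d choose i)"
proof (induction d arbitrary: i)
  case 0
  show ?case by (cases i) auto
next
  case (Suc d)
  show ?case
    by (cases i) (simp_all add: left_diff_distrib Suc.IH algebra_simps)
qed

text \<open>Reflection sends the nonzero constant coefficient to \<open>coeff p d\<close>, which
  forces \<open>d\<close> to be the degree.\<close>

lemma palindromic_of_reflection:
  fixes p :: "'a::zero poly"
  assumes "\<And>h. h \<le> d \<Longrightarrow> coeff p h = coeff p (d - h)" and "\<And>h. d < h \<Longrightarrow> coeff p h = 0"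
    and "coeff p 0 \<noteq> 0"
  shows "palindromic p"
proof -
  have "coeff p d \<noteq> 0" using assms(1)[of d] assms(3) by simp
  then have deg: "degree p = d" using assms(2) by (intro antisym degree_le le_degree) auto
  show ?thesis unfolding palindromic_def deg by (intro allI impI assms(1))
qed

text \<open>The alternating sum over all \<open>i \<le> n + 1\<close> vanishes, so a numerator
  coefficient is minus its complementary tail. Reversing \<open>i\<close> and reflecting the
  argument of \<open>g\<close> turns the tail into the coefficient at
  \<open>n - k - h\<close>.\<close>

lemma reciprocal_series_palindromic:
  fixes g :: "int \<Rightarrow> int"
  assumes "k \<le> n" and deg: "degree_less (Suc n) g"
    and vanish: "\<And>t. - int k \<le> t \<Longrightarrow> t < 0 \<Longrightarrow> g t = 0"
    and refl: "\<And>t. - int k \<le> t \<Longrightarrow> g (- t - int k - 1) = (-1) ^ n * g t"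
    and "g 0 \<noteq> 0"
  shows "\<exists>p. fps_of_poly p = (1 - fps_X) ^ (n + 1) * Abs_fps (\<lambda>t. g (int t)) \<and> palindromic p"
proof -
  define c where "c i = (-1) ^ i * int (Suc n choose i)" for i
  define a where "a h = (\<Sum>i\<le>h. c i * g (int h - int i))" for h :: nat
  have total: "(\<Sum>i\<le>Suc n. c i * g (h - int i)) = 0" for h
    using degree_less_alternating_sum[OF deg] by (simp only: c_def)
  have series: "fps_nth ((1 - fps_X) ^ (n + 1) * Abs_fps (\<lambda>t. g (int t))) h = a h" for h
    by (auto simp: fps_mult_nth one_minus_X_power_nth a_def c_def atLeast0AtMost of_nat_diff
        simp del: power_Suc binomial_Suc_Suc intro!: sum.cong)
  have large: "a h = 0" if "n < h" for h
  proof -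
    have "a h = (\<Sum>i\<le>Suc n. c i * g (int h - int i))"
      unfolding a_def using that
      by (intro sum.mono_neutral_right) (auto simp: c_def simp del: binomial_Suc_Suc)
    then show ?thesis by (simp only: total)
  qed
  have rev: "a h = (\<Sum>i\<le>n - h. c i * g (int n - int k - int h - int i))" if h: "h \<le> n" for h
  proof -
    have "(\<Sum>i\<le>Suc n. c i * g (int h - int i))
        = a h + (\<Sum>i\<in>{Suc h..Suc n}. c i * g (int h - int i))"
    proof -
      have "{..Suc n} = {..h} \<union> {Suc h..Suc n}" using h by auto
      then show ?thesis unfolding a_def by (simp only:) (intro sum.union_disjoint, auto)
    qed
    then have "a h = - (\<Sum>i\<in>{Suc h..Suc n}. c i * g (int h - int i))"
      using total[of "int h"] by linarith
    also have "(\<Sum>i\<in>{Suc h..Suc n}. c i * g (int h - int i))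
        = (\<Sum>i\<le>n - h. - (c i * g (int n - int k - int h - int i)))"
    proof (rule sum.reindex_bij_witness[where i = "\<lambda>i. Suc n - i" and j = "\<lambda>i. Suc n - i"])
      fix i assume i: "i \<in> {Suc h..Suc n}"
      define i' where "i' = Suc n - i"
      have i': "i = Suc n - i'" "i' \<le> n - h" "i' \<le> Suc n" using i by (auto simp: i'_def)
      have "int h - int i = - (int n - int k - int h - int i') - int k - 1"
        using i' by (simp add: of_nat_diff)
      moreover have "- int k \<le> int n - int k - int h - int i'" using i' h by linarith
      ultimately have g: "g (int h - int i) = (-1) ^ n * g (int n - int k - int h - int i')"
        using refl[of "int n - int k - int h - int i'"] by (simp only:)
      have choose: "Suc n choose i = Suc n choose i'"
        using i' binomial_symmetric[of i' "Suc n"] by simp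
      \<comment> \<open>\<open>i + n = 2 n + 1 - i'\<close> has parity opposite to
        \<open>i'\<close>; this sign cancels the one from passing to the tail.\<close>
      have sign: "(-1::int) ^ i * (-1) ^ n = - ((-1) ^ i')"
        using i' by (auto simp: minus_one_power_iff)
      have "c i * g (int h - int i)
          = (-1) ^ i * (-1) ^ n * int (Suc n choose i) * g (int n - int k - int h - int i')"
        unfolding c_def g by (simp only: ac_simps)
      then show "- (c (Suc n - i) * g (int n - int k - int h - int (Suc n - i)))
          = c i * g (int h - int i)"
        unfolding c_def sign choose i'_def[symmetric] by (simp only: mult_minus_left)
    qed (use h in auto)
    finally show ?thesis by (simp add: sum_negf)
  qed
  have small: "a h = a (n - k - h)" if h: "h \<le> n - k" for h
  proof -
    have "a h = (\<Sum>i\<le>n - h. c i * g (int n - int k - int h - int i))"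
      using h by (intro rev) auto
    \<comment> \<open>The dropped terms have \<open>n - k - h < i \<le> n - h\<close>, which puts
      the argument of \<open>g\<close> between \<open>- k\<close> and \<open>- 1\<close>.\<close>
    also have "\<dots> = (\<Sum>i\<le>n - k - h. c i * g (int n - int k - int h - int i))"
      using h \<open>k \<le> n\<close> by (intro sum.mono_neutral_right) (auto intro!: vanish)
    also have "\<dots> = a (n - k - h)"
      using h \<open>k \<le> n\<close> by (simp add: a_def of_nat_diff diff_diff_eq)
    finally show ?thesis .
  qed
  have mid: "a h = 0" if h: "n - k < h" for h
  proof (cases "h \<le> n")
    case True
    \<comment> \<open>Now even \<open>i = 0\<close> gives a negative argument, and
      \<open>i \<le> n - h\<close> keeps it at least \<open>- k\<close>.\<close>
    have "g (int n - int k - int h - int i) = 0" if "i \<le> n - h" for i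
      using h that True by (intro vanish) auto
    then show ?thesis by (simp add: rev[OF True])
  qed (use large in auto)
  define p where "p = Poly (map a [0..<Suc (n - k)])"
  have p: "coeff p h = a h" for h
    using mid[of h] by (auto simp: p_def nth_default_def simp del: upt_Suc)
  have "fps_of_poly p = (1 - fps_X) ^ (n + 1) * Abs_fps (\<lambda>t. g (int t))"
    by (rule fps_ext) (simp only: fps_of_poly_nth p series)
  moreover have "palindromic p"
  proof (rule palindromic_of_reflection[of "n - k"])
    show "coeff p h = coeff p (n - k - h)" if "h \<le> n - k" for h
      unfolding p by (rule small[OF that])
    show "coeff p h = 0" if "n - k < h" for h
      unfolding p by (rule mid[OF that])
    show "coeff p 0 \<noteq> 0" using \<open>g 0 \<noteq> 0\<close> by (simp add: p a_def c_def)
  qed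
  ultimately show ?thesis by blast
qed

theorem theorem2p10:
  fixes k n :: nat
  assumes "1 \<le> k" and "k \<le> n"
  shows "\<exists>p :: int poly. fps_of_poly p = hstar n (Bhat k n) \<and> palindromic p"
proof -
  let ?g = "\<lambda>T. iterated_sum k n 0 T 0"
  \<comment> \<open>The map sending \<open>t\<close> to \<open>- t - k - 1\<close> preserves the
    range from \<open>- k\<close> to \<open>- 1\<close>, where \<open>window_points\<close> is
    empty.\<close>
  have neg: "?g t = 0" if "- int k \<le> t" "t < 0" for t
    using iterated_sum_reciprocity[OF assms, of "- t - int k - 1"] that
      window_points_negative[OF assms, of "- t - int k - 1"] by simp
  have refl: "?g (- t - int k - 1) = (-1) ^ n * ?g t" if "- int k \<le> t" for t
    using iterated_sum_reciprocity[OF assms that] neg[OF that] window_points_negative[OF assms]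
      iterated_sum_window_points[OF assms] by (cases "t < 0") auto
  have "?g 0 \<noteq> 0"
    using iterated_sum_window_points[OF assms, of 0] by (simp add: window_points_zero[OF assms])
  moreover have "hstar n (Bhat k n) = (1 - fps_X) ^ (n + 1) * Abs_fps (\<lambda>t. ?g (int t))"
    unfolding hstar_def by (simp add: ehrhart_Bhat[OF assms] iterated_sum_window_points[OF assms])
  ultimately show ?thesis
    using reciprocal_series_palindromic[where g = ?g and k = k and n = n] assms(2)
      degree_less_iterated_sum_scale neg refl by presburger
qed

end
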